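(* Let $a<b$, $c<d$, $p<q$ be real numbers, let $G=[a,b]\times[c,d]\times[p,q]\subset\mathbb{R}^3$, and let $f:G\to\mathbb{R}$ be convex on $G$. Put $\Delta_1=[a,b]\times[c,d]$, $\Delta_2=[a,b]\times[p,q]$, $\Delta_3=[c,d]\times[p,q]$. Then the following chain of inequalities holds: $$ \begin{aligned} & f\left(\tfrac{a+b}{2},\tfrac{c+d}{2},\tfrac{p+q}{2}\right)\\ &\le \frac{1}{3(b-a)}\int_a^b f\left(x,\tfrac{c+d}{2},\tfrac{p+q}{2}\right)dx+\frac{1}{3(d-c)}\int_c^d f\left(\tfrac{a+b}{2},y,\tfrac{p+q}{2}\right)dy+\frac{1}{3(q-p)}\int_p^q f\left(\tfrac{a+b}{2},\tfrac{c+d}{2},z\right)dz\\ &\le \frac{1}{(b-a)(d-c)(q-p)}\iiint_G f(x,y,z)\,dy\,dz\,dx\\ &\le \frac16\Bigg[\frac{1}{(b-a)(d-c)}\iint_{\Delta_1} f(x,y,p)\,dy\,dx+\frac{1}{(b-a)(d-c)}\iint_{\Delta_1} f(x,y,q)\,dy\,dx\\ &\qquad+\frac{1}{(b-a)(q-p)}\iint_{\Delta_2} f(x,c,z)\,dz\,dx+\frac{1}{(b-a)(q-p)}\iint_{\Delta_2} f(x,d,z)\,dz\,dx\\ &\qquad+\frac{1}{(d-c)(q-p)}\iint_{\Delta_3} f(a,y,z)\,dz\,dy+\frac{1}{(d-c)(q-p)}\iint_{\Delta_3} f(b,y,z)\,dz\,dy\Bigg]\\ &\le \frac{f(a,c,p)+f(a,d,p)+f(b,c,p)+f(b,d,p)}{8}+\frac{f(a,c,q)+f(a,d,q)+f(b,c,q)+f(b,d,q)}{8}.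 \end{aligned} $$
   Context: A function $f:G\to\mathbb{R}$ on the rectangular box $G=[a,b]\times[c,d]\times[p,q]$ is convex on $G$ if $f(tx+(1-t)u,\,ty+(1-t)v,\,tz+(1-t)w)\le t f(x,y,z)+(1-t)f(u,v,w)$ for all $(x,y,z),(u,v,w)\in G$ and $t\in[0,1]$. *)

theory Defs
  imports "HOL-Analysis.Analysis"
begin

end

theory Submission
  imports Defs
begin

text \<open>
  The whole chain comes from two one-variable facts about a convex function: the value at the centre
  of a box is at most the mean of the values at two points symmetric about it, and on an interval the
  graph lies below its chord.

  Applying the first fact in some of the variables only, and integrating, bounds the mean over a
  product box from below by the mean over the section through the midpoint of the other block
  (\<open>integral_midpoint_section_le\<close>); applying the second fact in one variable bounds it from above
  by the average of the means over the two end faces (\<open>integral_le_endpoint_sections\<close>). The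
  second inequality of the chain is the average of the lower bounds for the three choices of the
  free variable, and the third is the average of the upper bounds for the three pairs of opposite
  faces. The first inequality is the midpoint inequality on each of the three central segments.
  For the last one, iterating the chord estimate bounds the mean over each face by the mean of its four
  corners; each corner of the box lies on three of the six faces, which turns the weight
  \<open>1 / 24\<close> into \<open>1 / 8\<close>.

  A convex function on a closed box is bounded, and continuous in the interior, but it may jump
  on the boundary. All integrability questions are therefore settled on the open box, which carries
  the same integrals. The bounding functions that occur are products \<open>g x * h y\<close>, so Fubini's
  theorem enters only in the form that integrals of such products multiply.
\<close>

section \<open>Integrability of convex functions on boxes\<close>

lemma convex_on_affine_compose:
  assumes "convex_on T f" "convex S" "g ` S \<subseteq> T"
    and "\<And>x y u v. u + v = 1 \<Longrightarrow> g (u *\<^sub>R x + v *\<^sub>R y) = u *\<^sub>R g x + v *\<^sub>R g y"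
  shows "convex_on S (\<lambda>x. f (g x))"
  using assms unfolding convex_on_def by (auto simp: image_subset_iff)

lemma convex_on_section:
  fixes a b :: "'a::euclidean_space" and c d :: "'b::euclidean_space"
  assumes "convex_on (cbox (a, c) (b, d)) f"
  shows "y \<in> cbox c d \<Longrightarrow> convex_on (cbox a b) (\<lambda>x. f (x, y))"
    and "x \<in> cbox a b \<Longrightarrow> convex_on (cbox c d) (\<lambda>y. f (x, y))"
  by (rule convex_on_affine_compose[OF assms]; force simp flip: scaleR_left.add)+

lemma reflect_mem_cbox:
  fixes a b x :: "'a::euclidean_space"
  shows "a + b - x \<in> cbox a b \<longleftrightarrow> x \<in> cbox a b"
  by (auto simp: mem_box inner_diff_left inner_add_left)

lemma convex_on_midpoint_reflect:
  fixes a b x :: "'a::euclidean_space"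
  assumes "convex_on (cbox a b) f" "x \<in> cbox a b"
  shows "f ((1/2) *\<^sub>R (a + b)) \<le> (f x + f (a + b - x)) / 2"
proof -
  have "f ((1 - 1/2) *\<^sub>R x + (1/2) *\<^sub>R (a + b - x)) \<le> (1 - 1/2) * f x + (1/2) * f (a + b - x)"
    by (rule convex_onD[OF assms(1)]) (use assms(2) in \<open>auto simp: reflect_mem_cbox\<close>)
  moreover have "(1 - 1/2) *\<^sub>R x + (1/2) *\<^sub>R (a + b - x) = (1/2) *\<^sub>R (a + b)"
    by (simp add: algebra_simps)
  ultimately show ?thesis by simp
qed

text \<open>
  A box is the convex hull of finitely many vertices, which bounds the function from above;
  the midpoint inequality then turns an upper bound at the reflected point into a lower bound.
\<close>

lemma convex_on_cbox_bounded:
  fixes f :: "'a::euclidean_space \<Rightarrow> real"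
  assumes "convex_on (cbox a b) f"
  obtains B where "\<And>x. x \<in> cbox a b \<Longrightarrow> \<bar>f x\<bar> \<le> B"
proof -
  obtain V where V: "finite V" "cbox a b = convex hull V"
    using polytope_interval[of a b] unfolding polytope_def by blast
  have "\<forall>x\<in>V. f x \<le> (\<Sum>v\<in>V. \<bar>f v\<bar>)"
    using V(1) by (meson abs_ge_self abs_ge_zero member_le_sum order_trans)
  then have up: "f x \<le> (\<Sum>v\<in>V. \<bar>f v\<bar>)" if "x \<in> cbox a b" for x
    using convex_on_convex_hull_bound[of V f] assms that V(2) by auto
  (* f x is at least 2 * f centre - (upper bound at the reflected point) *)
  define B where "B = (\<Sum>v\<in>V. \<bar>f v\<bar>) + 2 * \<bar>f ((1/2) *\<^sub>R (a + b))\<bar>"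
  have "\<bar>f x\<bar> \<le> B" if x: "x \<in> cbox a b" for x
    using up[OF x] up[of "a + b - x"] convex_on_midpoint_reflect[OF assms x] x
    unfolding B_def reflect_mem_cbox by (simp add: field_simps)
  then show thesis by (rule that)
qed

text \<open>
  In the interior convexity forces continuity and hence Borel measurability; on the boundary of the
  closed box the values are bounded but need not fit together continuously.
\<close>

lemma set_integrable_convex_on_box:
  fixes f :: "'a::euclidean_space \<Rightarrow> real"
  assumes "convex_on (cbox a b) f"
  shows "set_integrable lborel (box a b) f"
proof -
  obtain B where B: "\<And>x. x \<in> cbox a b \<Longrightarrow> \<bar>f x\<bar> \<le> B"
    using convex_on_cbox_bounded[OF assms] by blast
  have "continuous_on (box a b) f"
    using assms by (intro convex_on_continuous convex_on_subset[OF assms])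
      (auto simp: box_subset_cbox)
  then have "(\<lambda>x. indicator (box a b) x *\<^sub>R f x) \<in> borel_measurable lborel"
    using borel_measurable_continuous_on_indicator[of "box a b" f] by simp
  then have "integrable lborel (\<lambda>x. indicator (box a b) x *\<^sub>R (indicator (box a b) x *\<^sub>R f x))"
    by (intro integrableI_bounded_set_indicator[where B = B])
      (use B box_subset_cbox[of a b] in \<open>auto intro!: AE_I2 simp: emeasure_lborel_box_eq\<close>)
  moreover have "indicator (box a b) x *\<^sub>R (indicator (box a b) x *\<^sub>R f x)
      = indicator (box a b) x *\<^sub>R f x" for x
    by (simp add: indicator_def)
  ultimately show ?thesis
    by (simp only: set_integrable_def)
qed

lemma integrable_on_cbox_convex:
  fixes f :: "'a::euclidean_space \<Rightarrow> real"
  assumes "convex_on (cbox a b) f"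
  shows "f integrable_on cbox a b"
  using set_borel_integral_eq_integral(1)[OF set_integrable_convex_on_box[OF assms]]
  by (simp add: integrable_on_open_interval)

section \<open>Integrals over product boxes\<close>

text \<open>
  Borel integrability on the open boxes gives access to Fubini's theorem for products of
  \<^const>\<open>lborel\<close>; the boundaries are negligible, so the result may be stated on closed boxes.
\<close>

lemma has_integral_product_box:
  fixes g :: "'a::euclidean_space \<Rightarrow> real" and h :: "'b::euclidean_space \<Rightarrow> real"
  assumes "set_integrable lborel (box a b) g" "set_integrable lborel (box c d) h"
  shows "((\<lambda>(x, y). g x * h y) has_integral integral (cbox a b) g * integral (cbox c d) h)
           (cbox (a, c) (b, d))"
proof -
  define G where "G = (\<lambda>x. indicator (box a b) x *\<^sub>R g x)"
  define H where "H = (\<lambda>x. indicator (box c d) x *\<^sub>R h x)"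
  have G: "integrable lborel G" and H: "integrable lborel H"
    using assms by (auto simp: set_integrable_def G_def H_def)
  have [measurable]: "G \<in> borel_measurable borel" "H \<in> borel_measurable borel"
    using borel_measurable_integrable[OF G] borel_measurable_integrable[OF H] by auto
  have int: "integrable (lborel \<Otimes>\<^sub>M lborel) (\<lambda>z. G (fst z) * H (snd z))"
    using G H by (intro lborel_pair.Fubini_integrable) (auto simp: abs_mult)
  have eq: "integral\<^sup>L (lborel \<Otimes>\<^sub>M lborel) (\<lambda>z. G (fst z) * H (snd z))
      = integral\<^sup>L lborel G * integral\<^sup>L lborel H"
    using lborel_pair.integral_fst'[OF int] by simp
  have box: "box (a, c) (b, d) = box a b \<times> box c d"
    by (force simp: box_def Basis_prod_def)
  have ind: "indicator (box (a, c) (b, d)) z *\<^sub>R (case z of (x, y) \<Rightarrow> g x * h y) = G (fst z) * H (snd z)" for z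
    by (auto simp: box G_def H_def indicator_def split: prod.split)
  have si: "set_integrable lborel (box (a, c) (b, d)) (\<lambda>(x, y). g x * h y)"
    unfolding set_integrable_def ind using int by (simp add: lborel_prod)
  have "integral (box (a, c) (b, d)) (\<lambda>(x, y). g x * h y) = integral (box a b) g * integral (box c d) h"
    using eq unfolding set_borel_integral_eq_integral(2)[OF si, symmetric]
      set_borel_integral_eq_integral(2)[OF assms(1), symmetric]
      set_borel_integral_eq_integral(2)[OF assms(2), symmetric]
    unfolding set_lebesgue_integral_def ind G_def H_def by (simp add: lborel_prod)
  then show ?thesis
    using set_borel_integral_eq_integral(1)[OF si]
    by (simp add: has_integral_iff integrable_on_open_interval integral_open_interval)
qed

lemma image_eq_if_right_inverse:
  assumes "\<And>x. g x \<in> T \<longleftrightarrow> x \<in> S" and "\<And>y. g (h y) = y"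
  shows "g ` S = T"
  using assms by (metis image_eqI image_subset_iff subset_antisym subsetI)

text \<open>
  This and the two lemmas after it are changes of variables by maps that send boxes to boxes of the same
  volume.
\<close>

lemma has_integral_reflect_snd:
  fixes f :: "'a::euclidean_space \<times> 'b::euclidean_space \<Rightarrow> real"
  assumes "(f has_integral i) (cbox (a, c) (b, d))"
  shows "((\<lambda>(x, y). f (x, c + d - y)) has_integral i) (cbox (a, c) (b, d))"
proof -
  define r :: "'a \<times> 'b \<Rightarrow> 'a \<times> 'b" where "r z = (fst z, c + d - snd z)" for z
  have rr: "r (r z) = z" for z by (simp add: r_def)
  have "c + d - y \<in> cbox (c + d - v) (c + d - u) \<longleftrightarrow> y \<in> cbox u v" for y u v
    by (auto simp: mem_box inner_diff_left inner_add_left)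
  then have "r z \<in> cbox (fst u, c + d - snd v) (fst v, c + d - snd u) \<longleftrightarrow> z \<in> cbox u v" for z u v
    by (cases z; cases u; cases v) (simp add: r_def)
  then have im: "r ` cbox u v = cbox (fst u, c + d - snd v) (fst v, c + d - snd u)" for u v
    by (rule image_eq_if_right_inverse) (rule rr)
  (* the volume of a box depends only on its side lengths, which reflection preserves *)
  have len: "measure lborel (cbox (c + d - z) (c + d - w)) = measure lborel (cbox w z)" for w z :: 'b
    by (simp add: measure_lborel_cbox_eq inner_diff_left inner_add_left)
  have "((\<lambda>x. f (r x)) has_integral (1 / 1) *\<^sub>R i) (r ` cbox (a, c) (b, d))"
  proof (rule has_integral_twiddle[where r = 1])
    show "\<exists>w z. r ` cbox u v = cbox w z" "\<exists>w z. r ` cbox u v = cbox w z" for u v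
      by (intro exI, rule im)+
    show "measure lborel (r ` cbox u v) = 1 * measure lborel (cbox u v)" for u v
      unfolding im by (cases u; cases v) (simp add: content_Pair len)
    show "continuous (at z) r" for z
      unfolding r_def by (intro continuous_intros)
  qed (use assms rr in auto)
  then show ?thesis unfolding im by (simp add: r_def case_prod_unfold)
qed

text \<open>
  Together with the next lemma this moves any one of three variables to the front, so that the
  estimates below need to treat the first variable only.
\<close>

lemma has_integral_swap_first_two:
  fixes f :: "'a::euclidean_space \<times> 'b::euclidean_space \<times> 'c::euclidean_space \<Rightarrow> real"
  assumes "(f has_integral i) (cbox (a, c, p) (b, d, q))"
  shows "((\<lambda>(y, x, z). f (x, y, z)) has_integral i) (cbox (c, a, p) (d, b, q))"
proof -
  define g :: "'b \<times> 'a \<times> 'c \<Rightarrow> 'a \<times> 'b \<times> 'c" where "g t = (fst (snd t), fst t, snd (snd t))" for t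
  define h :: "'a \<times> 'b \<times> 'c \<Rightarrow> 'b \<times> 'a \<times> 'c" where "h t = (fst (snd t), fst t, snd (snd t))" for t
  have gh: "g (h t) = t" and hg: "h (g t') = t'" for t t' by (simp_all add: g_def h_def)
  have "g t \<in> cbox (g u) (g v) \<longleftrightarrow> t \<in> cbox u v" for t u v
    by (cases t; cases u; cases v) (auto simp: g_def)
  then have img: "g ` cbox u v = cbox (g u) (g v)" for u v
    by (rule image_eq_if_right_inverse) (rule gh)
  have "h t \<in> cbox (h u) (h v) \<longleftrightarrow> t \<in> cbox u v" for t u v
    by (cases t; cases u; cases v) (auto simp: h_def)
  then have imh: "h ` cbox u v = cbox (h u) (h v)" for u v
    by (rule image_eq_if_right_inverse) (rule hg)
  have "((\<lambda>x. f (g x)) has_integral (1 / 1) *\<^sub>R i) (h ` cbox (a, c, p) (b, d, q))"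
  proof (rule has_integral_twiddle[where r = 1])
    show "\<exists>w z. g ` cbox u v = cbox w z" "\<exists>w z. h ` cbox u' v' = cbox w z" for u v u' v'
      by (intro exI, rule img imh)+
    show "measure lborel (g ` cbox u v) = 1 * measure lborel (cbox u v)" for u v
      unfolding img by (cases u; cases v) (simp add: g_def content_Pair)
    show "continuous (at t) g" for t
      unfolding g_def by (intro continuous_intros)
  qed (use assms gh hg in auto)
  then show ?thesis unfolding imh by (simp add: g_def h_def case_prod_unfold)
qed

lemma has_integral_rotate:
  fixes f :: "'a::euclidean_space \<times> 'b::euclidean_space \<times> 'c::euclidean_space \<Rightarrow> real"
  assumes "(f has_integral i) (cbox (a, c, p) (b, d, q))"
  shows "((\<lambda>(z, x, y). f (x, y, z)) has_integral i) (cbox (p, a, c) (q, b, d))"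
proof -
  define g :: "'c \<times> 'a \<times> 'b \<Rightarrow> 'a \<times> 'b \<times> 'c" where "g t = (fst (snd t), snd (snd t), fst t)" for t
  define h :: "'a \<times> 'b \<times> 'c \<Rightarrow> 'c \<times> 'a \<times> 'b" where "h t = (snd (snd t), fst t, fst (snd t))" for t
  have gh: "g (h t) = t" and hg: "h (g t') = t'" for t t' by (simp_all add: g_def h_def)
  have "g t \<in> cbox (g u) (g v) \<longleftrightarrow> t \<in> cbox u v" for t u v
    by (cases t; cases u; cases v) (auto simp: g_def)
  then have img: "g ` cbox u v = cbox (g u) (g v)" for u v
    by (rule image_eq_if_right_inverse) (rule gh)
  have "h t \<in> cbox (h u) (h v) \<longleftrightarrow> t \<in> cbox u v" for t u v
    by (cases t; cases u; cases v) (auto simp: h_def)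
  then have imh: "h ` cbox u v = cbox (h u) (h v)" for u v
    by (rule image_eq_if_right_inverse) (rule hg)
  have "((\<lambda>x. f (g x)) has_integral (1 / 1) *\<^sub>R i) (h ` cbox (a, c, p) (b, d, q))"
  proof (rule has_integral_twiddle[where r = 1])
    show "\<exists>w z. g ` cbox u v = cbox w z" "\<exists>w z. h ` cbox u' v' = cbox w z" for u v u' v'
      by (intro exI, rule img imh)+
    show "measure lborel (g ` cbox u v) = 1 * measure lborel (cbox u v)" for u v
      unfolding img by (cases u; cases v) (simp add: g_def content_Pair)
    show "continuous (at t) g" for t
      unfolding g_def by (intro continuous_intros)
  qed (use assms gh hg in auto)
  then show ?thesis unfolding imh by (simp add: g_def h_def case_prod_unfold)
qed

section \<open>Midpoint and endpoint estimates in one block of variables\<close>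

text \<open>
  The function and its reflection about the midpoint have the same integral, and their mean
  dominates the value at the midpoint everywhere.
\<close>

lemma midpoint_le_integral:
  fixes f :: "real \<Rightarrow> real"
  assumes "a < b" "convex_on {a..b} f"
  shows "(b - a) * f ((a + b) / 2) \<le> integral {a..b} f"
proof -
  have cv: "convex_on (cbox a b) f" using assms by simp
  define i where "i = integral {a..b} f"
  have i: "(f has_integral i) (cbox a b)"
    using integrable_on_cbox_convex[OF cv] by (simp add: i_def has_integral_integral)
  have "((\<lambda>x. f (a + b - x)) has_integral i) (cbox a b)"
    using has_integral_affinity[OF i, of "-1" "a + b"] image_affinity_cbox[of "-1" "a + b" a b] assms(1)
    by (simp add: algebra_simps)
  then have up: "((\<lambda>x. (f x + f (a + b - x)) / 2) has_integral (i + i) / 2) (cbox a b)"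
    by (intro has_integral_divide has_integral_add i)
  have low: "((\<lambda>x. f ((a + b) / 2)) has_integral (b - a) * f ((a + b) / 2)) (cbox a b)"
    using has_integral_const[of "f ((a + b) / 2)" a b] assms(1) by simp
  have "(b - a) * f ((a + b) / 2) \<le> (i + i) / 2"
    by (rule has_integral_le[OF low up]) (use convex_on_midpoint_reflect[OF cv] in auto)
  then show ?thesis by (simp add: i_def)
qed

text \<open>
  The same averaging as in the one-variable case, with only the second block of variables reflected:
  on each slice the mean of the function and its reflection dominates the value at the centre of the slice.
\<close>

lemma integral_midpoint_section_le:
  fixes f :: "'a::euclidean_space \<times> 'b::euclidean_space \<Rightarrow> real"
  assumes cv: "convex_on (cbox (a, c) (b, d)) f" and ne: "cbox c d \<noteq> {}"
  shows "measure lborel (cbox c d) * integral (cbox a b) (\<lambda>x. f (x, (1/2) *\<^sub>R (c + d)))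
           \<le> integral (cbox (a, c) (b, d)) f"
proof -
  define i where "i = integral (cbox (a, c) (b, d)) f"
  let ?m = "(1/2) *\<^sub>R (c + d)"
  have i: "(f has_integral i) (cbox (a, c) (b, d))"
    using integrable_on_cbox_convex[OF cv] by (simp add: i_def has_integral_integral)
  have avg: "((\<lambda>z. (f z + (case z of (x, y) \<Rightarrow> f (x, c + d - y))) / 2) has_integral (i + i) / 2)
          (cbox (a, c) (b, d))"
    by (intro has_integral_divide has_integral_add i has_integral_reflect_snd)
  have "?m \<in> cbox c d"
    using ne by (force simp: mem_box inner_add_left box_ne_empty)
  then have "set_integrable lborel (box a b) (\<lambda>x. f (x, ?m))"
    by (intro set_integrable_convex_on_box convex_on_section(1)[OF cv])
  moreover have "set_integrable lborel (box c d) (\<lambda>y. 1::real)"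
    by (rule set_integrable_convex_on_box) (simp add: convex_on_def)
  ultimately have "((\<lambda>(x, y). f (x, ?m) * 1) has_integral
      integral (cbox a b) (\<lambda>x. f (x, ?m)) * integral (cbox c d) (\<lambda>y. 1)) (cbox (a, c) (b, d))"
    by (rule has_integral_product_box)
  then have "integral (cbox a b) (\<lambda>x. f (x, ?m)) * integral (cbox c d) (\<lambda>y. 1) \<le> (i + i) / 2"
    using avg
  proof (rule has_integral_le)
    fix z assume "z \<in> cbox (a, c) (b, d)"
    then obtain x y where z: "z = (x, y)" "x \<in> cbox a b" "y \<in> cbox c d" by (cases z) auto
    show "(case z of (x, y) \<Rightarrow> f (x, ?m) * 1) \<le> (f z + (case z of (x, y) \<Rightarrow> f (x, c + d - y))) / 2"
      using convex_on_midpoint_reflect[OF convex_on_section(2)[OF cv z(2)] z(3)] z(1) by simp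
  qed
  then show ?thesis by (simp add: i_def mult.commute)
qed

lemma convex_on_chord_le:
  fixes a b x :: real
  assumes "a < b" "convex_on {a..b} f" "x \<in> {a..b}"
  shows "f x \<le> (b - x) / (b - a) * f a + (x - a) / (b - a) * f b"
proof -
  define t where "t = (x - a) / (b - a)"
  have t: "0 \<le> t" "t \<le> 1" "1 - t = (b - x) / (b - a)" "(1 - t) *\<^sub>R a + t *\<^sub>R b = x"
    using assms(1,3) by (auto simp: t_def divide_simps) (simp add: algebra_simps)
  have "f ((1 - t) *\<^sub>R a + t *\<^sub>R b) \<le> (1 - t) * f a + t * f b"
    using assms t by (intro convex_onD[OF assms(2)]) auto
  then have "f x \<le> (1 - t) * f a + t * f b" by (simp only: t(4))
  then show ?thesis by (simp only: t(3)) (simp only: t_def)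
qed

lemma has_integral_chord_weights:
  fixes a b :: real
  assumes "a < b"
  shows "((\<lambda>x. (b - x) / (b - a)) has_integral (b - a) / 2) {a..b}"
    and "((\<lambda>x. (x - a) / (b - a)) has_integral (b - a) / 2) {a..b}"
proof -
  have id: "((\<lambda>x. x) has_integral (b\<^sup>2 - a\<^sup>2) / 2) {a..b}"
    using ident_has_integral[of a b] assms by simp
  have const: "((\<lambda>x. e) has_integral (b - a) * e) {a..b}" for e :: real
    using has_integral_const_real[of e a b] assms by simp
  have eqs: "((b - a) * b - (b\<^sup>2 - a\<^sup>2) / 2) / (b - a) = (b - a) / 2"
    "((b\<^sup>2 - a\<^sup>2) / 2 - (b - a) * a) / (b - a) = (b - a) / 2"
    using assms by (simp_all add: divide_simps) (simp_all add: algebra_simps power2_eq_square)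
  show "((\<lambda>x. (b - x) / (b - a)) has_integral (b - a) / 2) {a..b}"
    by (rule has_integral_eq_rhs[OF has_integral_divide[OF has_integral_diff[OF const id]] eqs(1)[symmetric]])
  show "((\<lambda>x. (x - a) / (b - a)) has_integral (b - a) / 2) {a..b}"
    by (rule has_integral_eq_rhs[OF has_integral_divide[OF has_integral_diff[OF id const]] eqs(2)[symmetric]])
qed

lemma integral_le_endpoints:
  fixes f :: "real \<Rightarrow> real"
  assumes "a < b" "convex_on {a..b} f"
  shows "integral {a..b} f \<le> (b - a) / 2 * (f a + f b)"
proof -
  have up: "((\<lambda>x. (b - x) / (b - a) * f a + (x - a) / (b - a) * f b) has_integral
      (b - a) / 2 * f a + (b - a) / 2 * f b) {a..b}"
    by (intro has_integral_add has_integral_mult_left has_integral_chord_weights assms(1))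
  have low: "(f has_integral integral {a..b} f) {a..b}"
    using integrable_on_cbox_convex[of a b f] assms(2) by (simp add: has_integral_integral)
  have "integral {a..b} f \<le> (b - a) / 2 * f a + (b - a) / 2 * f b"
    by (rule has_integral_le[OF low up]) (rule convex_on_chord_le[OF assms])
  then show ?thesis by (simp only: distrib_left)
qed

text \<open>
  On each line in the direction of the first variable the function lies below its chord. The chord
  is a sum of two products, each of a weight in the first variable with the restriction of the
  function to an end face, and each weight has integral \<open>(b - a) / 2\<close>.
\<close>

lemma integral_le_endpoint_sections:
  fixes f :: "real \<times> 'b::euclidean_space \<Rightarrow> real"
  assumes ab: "a < b" and cv: "convex_on (cbox (a, c) (b, d)) f"
  shows "integral (cbox (a, c) (b, d)) f \<le> (b - a) / 2 *
           (integral (cbox c d) (\<lambda>y. f (a, y)) + integral (cbox c d) (\<lambda>y. f (b, y)))"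
proof -
  define A where "A = integral (cbox c d) (\<lambda>y. f (a, y))"
  define B where "B = integral (cbox c d) (\<lambda>y. f (b, y))"
  have sec: "set_integrable lborel (box c d) (\<lambda>y. f (e, y))" if "e \<in> cbox a b" for e
    by (rule set_integrable_convex_on_box[OF convex_on_section(2)[OF cv that]])
  have wts: "set_integrable lborel (box a b) (\<lambda>x. (b - x) / (b - a))"
    "set_integrable lborel (box a b) (\<lambda>x. (x - a) / (b - a))"
    using ab by (intro set_integrable_subset[OF borel_integrable_atLeastAtMost', of a b];
        auto intro!: continuous_intros)+
  have int_wts: "integral (cbox a b) (\<lambda>x. (b - x) / (b - a)) = (b - a) / 2"
    "integral (cbox a b) (\<lambda>x. (x - a) / (b - a)) = (b - a) / 2"
    using has_integral_chord_weights[OF ab, THEN integral_unique] by simp_all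
  have "((\<lambda>(x, y). (b - x) / (b - a) * f (a, y)) has_integral (b - a) / 2 * A) (cbox (a, c) (b, d))"
    using has_integral_product_box[OF wts(1) sec[of a], unfolded int_wts] ab
    by (simp add: A_def)
  moreover have "((\<lambda>(x, y). (x - a) / (b - a) * f (b, y)) has_integral (b - a) / 2 * B) (cbox (a, c) (b, d))"
    using has_integral_product_box[OF wts(2) sec[of b], unfolded int_wts] ab
    by (simp add: B_def)
  ultimately have up: "((\<lambda>z. (case z of (x, y) \<Rightarrow> (b - x) / (b - a) * f (a, y)) +
        (case z of (x, y) \<Rightarrow> (x - a) / (b - a) * f (b, y))) has_integral
      (b - a) / 2 * A + (b - a) / 2 * B) (cbox (a, c) (b, d))"
    by (rule has_integral_add)
  have low: "(f has_integral integral (cbox (a, c) (b, d)) f) (cbox (a, c) (b, d))"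
    using integrable_on_cbox_convex[OF cv] by (simp add: has_integral_integral)
  have "integral (cbox (a, c) (b, d)) f \<le> (b - a) / 2 * A + (b - a) / 2 * B"
  proof (rule has_integral_le[OF low up])
    fix z assume "z \<in> cbox (a, c) (b, d)"
    then obtain x y where z: "z = (x, y)" "x \<in> {a..b}" "y \<in> cbox c d" by (cases z) auto
    show "f z \<le> (case z of (x, y) \<Rightarrow> (b - x) / (b - a) * f (a, y)) +
        (case z of (x, y) \<Rightarrow> (x - a) / (b - a) * f (b, y))"
      using convex_on_chord_le[OF ab _ z(2), of "\<lambda>x. f (x, y)"] convex_on_section(1)[OF cv z(3)] z(1)
      by simp
  qed
  then show ?thesis by (simp only: A_def B_def distrib_left)
qed

lemma integral_le_corners:
  fixes f :: "real \<times> real \<Rightarrow> real"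
  assumes ab: "a < b" and cd: "c < d" and cv: "convex_on (cbox (a, c) (b, d)) f"
  shows "integral (cbox (a, c) (b, d)) f \<le> (b - a) * (d - c) *
           ((f (a, c) + f (a, d) + f (b, c) + f (b, d)) / 4)"
proof -
  have "integral (cbox (a, c) (b, d)) f \<le> (b - a) / 2 *
          (integral {c..d} (\<lambda>y. f (a, y)) + integral {c..d} (\<lambda>y. f (b, y)))"
    using integral_le_endpoint_sections[OF ab cv] by simp
  also have "\<dots> \<le> (b - a) / 2 * ((d - c) / 2 * (f (a, c) + f (a, d)) + (d - c) / 2 * (f (b, c) + f (b, d)))"
    using ab cd convex_on_section(2)[OF cv, of a] convex_on_section(2)[OF cv, of b]
    by (intro mult_left_mono add_mono integral_le_endpoints) auto
  also have "\<dots> = (b - a) * (d - c) * ((f (a, c) + f (a, d) + f (b, c) + f (b, d)) / 4)"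
    by (simp add: field_simps)
  finally show ?thesis .
qed

section \<open>The Hermite-Hadamard chain on a three-dimensional box\<close>

theorem theorem3:
  fixes a b c d p q :: real
    and f :: "real \<times> real \<times> real \<Rightarrow> real"
  assumes "a < b" and "c < d" and "p < q"
    and "convex_on ({a..b} \<times> {c..d} \<times> {p..q}) f"
  shows "(\<lambda>x. f (x, (c + d) / 2, (p + q) / 2)) integrable_on {a..b}
    \<and> (\<lambda>y. f ((a + b) / 2, y, (p + q) / 2)) integrable_on {c..d}
    \<and> (\<lambda>z. f ((a + b) / 2, (c + d) / 2, z)) integrable_on {p..q}
    \<and> f integrable_on ({a..b} \<times> {c..d} \<times> {p..q})
    \<and> (\<lambda>(x, y). f (x, y, p)) integrable_on ({a..b} \<times> {c..d})
    \<and> (\<lambda>(x, y). f (x, y, q)) integrable_on ({a..b} \<times> {c..d})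
    \<and> (\<lambda>(x, z). f (x, c, z)) integrable_on ({a..b} \<times> {p..q})
    \<and> (\<lambda>(x, z). f (x, d, z)) integrable_on ({a..b} \<times> {p..q})
    \<and> (\<lambda>(y, z). f (a, y, z)) integrable_on ({c..d} \<times> {p..q})
    \<and> (\<lambda>(y, z). f (b, y, z)) integrable_on ({c..d} \<times> {p..q})

    \<and> f ((a + b) / 2, (c + d) / 2, (p + q) / 2)
      \<le> 1 / (3 * (b - a)) * integral {a..b} (\<lambda>x. f (x, (c + d) / 2, (p + q) / 2))
        + 1 / (3 * (d - c)) * integral {c..d} (\<lambda>y. f ((a + b) / 2, y, (p + q) / 2))
        + 1 / (3 * (q - p)) * integral {p..q} (\<lambda>z. f ((a + b) / 2, (c + d) / 2, z))

    \<and> 1 / (3 * (b - a)) * integral {a..b} (\<lambda>x. f (x, (c + d) / 2, (p + q) / 2))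
        + 1 / (3 * (d - c)) * integral {c..d} (\<lambda>y. f ((a + b) / 2, y, (p + q) / 2))
        + 1 / (3 * (q - p)) * integral {p..q} (\<lambda>z. f ((a + b) / 2, (c + d) / 2, z))
      \<le> 1 / ((b - a) * (d - c) * (q - p))
          * integral ({a..b} \<times> {c..d} \<times> {p..q}) f

    \<and> 1 / ((b - a) * (d - c) * (q - p))
          * integral ({a..b} \<times> {c..d} \<times> {p..q}) f
      \<le> 1 / 6 *
         (1 / ((b - a) * (d - c)) * integral ({a..b} \<times> {c..d}) (\<lambda>(x, y). f (x, y, p))
        + 1 / ((b - a) * (d - c)) * integral ({a..b} \<times> {c..d}) (\<lambda>(x, y). f (x, y, q))
        + 1 / ((b - a) * (q - p)) * integral ({a..b} \<times> {p..q}) (\<lambda>(x, z). f (x, c, z))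
        + 1 / ((b - a) * (q - p)) * integral ({a..b} \<times> {p..q}) (\<lambda>(x, z). f (x, d, z))
        + 1 / ((d - c) * (q - p)) * integral ({c..d} \<times> {p..q}) (\<lambda>(y, z). f (a, y, z))
        + 1 / ((d - c) * (q - p)) * integral ({c..d} \<times> {p..q}) (\<lambda>(y, z). f (b, y, z)))

    \<and> 1 / 6 *
         (1 / ((b - a) * (d - c)) * integral ({a..b} \<times> {c..d}) (\<lambda>(x, y). f (x, y, p))
        + 1 / ((b - a) * (d - c)) * integral ({a..b} \<times> {c..d}) (\<lambda>(x, y). f (x, y, q))
        + 1 / ((b - a) * (q - p)) * integral ({a..b} \<times> {p..q}) (\<lambda>(x, z). f (x, c, z))
        + 1 / ((b - a) * (q - p)) * integral ({a..b} \<times> {p..q}) (\<lambda>(x, z). f (x, d, z))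
        + 1 / ((d - c) * (q - p)) * integral ({c..d} \<times> {p..q}) (\<lambda>(y, z). f (a, y, z))
        + 1 / ((d - c) * (q - p)) * integral ({c..d} \<times> {p..q}) (\<lambda>(y, z). f (b, y, z)))
      \<le> (f (a, c, p) + f (a, d, p) + f (b, c, p) + f (b, d, p)) / 8
        + (f (a, c, q) + f (a, d, q) + f (b, c, q) + f (b, d, q)) / 8"
proof -
  let ?x = "(a + b) / 2" and ?y = "(c + d) / 2" and ?z = "(p + q) / 2"
  have G: "{a..b} \<times> {c..d} \<times> {p..q} = cbox (a, c, p) (b, d, q)"
    and D1: "{a..b} \<times> {c..d} = cbox (a, c) (b, d)"
    and D2: "{a..b} \<times> {p..q} = cbox (a, p) (b, q)"
    and D3: "{c..d} \<times> {p..q} = cbox (c, p) (d, q)"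
    by (simp_all add: cbox_Pair_eq)
  (* f with its second, respectively third, variable moved to the front *)
  define g where "g = (\<lambda>(y, x, z). f (x, y, z))"
  define h where "h = (\<lambda>(z, x, y). f (x, y, z))"
  have fc: "convex_on (cbox (a, c, p) (b, d, q)) f" using assms(4) by (simp add: G)
  have gc: "convex_on (cbox (c, a, p) (d, b, q)) g"
    unfolding g_def case_prod_unfold by (rule convex_on_affine_compose[OF fc]) auto
  have hc: "convex_on (cbox (p, a, c) (q, b, d)) h"
    unfolding h_def case_prod_unfold by (rule convex_on_affine_compose[OF fc]) auto

  define I where "I = integral (cbox (a, c, p) (b, d, q)) f"
  have fI: "(f has_integral I) (cbox (a, c, p) (b, d, q))"
    using integrable_on_cbox_convex[OF fc] by (simp add: I_def has_integral_integral)
  have gI: "integral (cbox (c, a, p) (d, b, q)) g = I"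
    using has_integral_swap_first_two[OF fI] by (simp add: g_def integral_unique)
  have hI: "integral (cbox (p, a, c) (q, b, d)) h = I"
    using has_integral_rotate[OF fI] by (simp add: h_def integral_unique)

  have xc: "convex_on {a..b} (\<lambda>x. f (x, ?y, ?z))"
    using convex_on_section(1)[OF fc, of "(?y, ?z)"] assms by simp
  have yc: "convex_on {c..d} (\<lambda>y. f (?x, y, ?z))"
    using convex_on_section(1)[OF gc, of "(?x, ?z)"] assms by (simp add: g_def)
  have zc: "convex_on {p..q} (\<lambda>z. f (?x, ?y, z))"
    using convex_on_section(1)[OF hc, of "(?x, ?y)"] assms by (simp add: h_def)
  have D1c: "convex_on (cbox (a, c) (b, d)) (\<lambda>(x, y). f (x, y, e))" if "e \<in> {p..q}" for e
    using convex_on_section(2)[OF hc, of e] that by (simp add: h_def case_prod_unfold)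
  have D2c: "convex_on (cbox (a, p) (b, q)) (\<lambda>(x, z). f (x, e, z))" if "e \<in> {c..d}" for e
    using convex_on_section(2)[OF gc, of e] that by (simp add: g_def case_prod_unfold)
  have D3c: "convex_on (cbox (c, p) (d, q)) (\<lambda>(y, z). f (e, y, z))" if "e \<in> {a..b}" for e
    using convex_on_section(2)[OF fc, of e] that by (simp add: case_prod_unfold)

  (* X, Y, Z are the integrals over the three central segments; P, C, A those over the sections
     of the box where the third, second or first variable is fixed *)
  define X where "X = integral {a..b} (\<lambda>x. f (x, ?y, ?z))"
  define Y where "Y = integral {c..d} (\<lambda>y. f (?x, y, ?z))"
  define Z where "Z = integral {p..q} (\<lambda>z. f (?x, ?y, z))"
  define P where "P e = integral (cbox (a, c) (b, d)) (\<lambda>(x, y). f (x, y, e))" for e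
  define C where "C e = integral (cbox (a, p) (b, q)) (\<lambda>(x, z). f (x, e, z))" for e
  define A where "A e = integral (cbox (c, p) (d, q)) (\<lambda>(y, z). f (e, y, z))" for e

  define u v w where "u = b - a" and "v = d - c" and "w = q - p"
  have pos: "u > 0" "v > 0" "w > 0" using assms by (auto simp: u_def v_def w_def)

  have "u * f (?x, ?y, ?z) \<le> X" "v * f (?x, ?y, ?z) \<le> Y" "w * f (?x, ?y, ?z) \<le> Z"
    using midpoint_le_integral[OF assms(1) xc] midpoint_le_integral[OF assms(2) yc]
      midpoint_le_integral[OF assms(3) zc] by (simp_all add: u_def v_def w_def X_def Y_def Z_def)
  then have "f (?x, ?y, ?z) \<le> X / u" "f (?x, ?y, ?z) \<le> Y / v" "f (?x, ?y, ?z) \<le> Z / w"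
    using pos by (simp_all add: pos_le_divide_eq mult.commute)
  then have first: "f (?x, ?y, ?z) \<le> 1 / (3 * u) * X + 1 / (3 * v) * Y + 1 / (3 * w) * Z"
    by simp

  have "(v * w) * X \<le> I" "(u * w) * Y \<le> I" "(u * v) * Z \<le> I"
    using integral_midpoint_section_le[OF fc] integral_midpoint_section_le[OF gc, unfolded gI]
      integral_midpoint_section_le[OF hc, unfolded hI] assms(1-3)
    by (simp_all add: I_def[symmetric] content_Pair cbox_Pair_eq_0 g_def h_def
        u_def v_def w_def X_def Y_def Z_def)
  then have "X / u \<le> I / (u * v * w)" "Y / v \<le> I / (u * v * w)" "Z / w \<le> I / (u * v * w)"
    using pos by (simp_all add: field_simps)
  then have second: "1 / (3 * u) * X + 1 / (3 * v) * Y + 1 / (3 * w) * Z \<le> 1 / (u * v * w) * I"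
    by simp

  have "I \<le> u / 2 * (A a + A b)" "I \<le> v / 2 * (C c + C d)" "I \<le> w / 2 * (P p + P q)"
    using integral_le_endpoint_sections[OF assms(1) fc] integral_le_endpoint_sections[OF assms(2) gc, unfolded gI]
      integral_le_endpoint_sections[OF assms(3) hc, unfolded hI]
    by (simp_all add: I_def[symmetric] g_def h_def
        u_def v_def w_def A_def C_def P_def case_prod_unfold)
  then have "I / (u * v * w) \<le> (A a + A b) / (v * w) / 2" "I / (u * v * w) \<le> (C c + C d) / (u * w) / 2"
    "I / (u * v * w) \<le> (P p + P q) / (u * v) / 2"
    using pos by (simp_all add: field_simps)
  then have third: "1 / (u * v * w) * I \<le> 1 / 6 * (1 / (u * v) * P p + 1 / (u * v) * P q
      + 1 / (u * w) * C c + 1 / (u * w) * C d + 1 / (v * w) * A a + 1 / (v * w) * A b)"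
    by (simp add: add_divide_distrib)

  have Pm: "1 / (u * v) * P e \<le> (f (a, c, e) + f (a, d, e) + f (b, c, e) + f (b, d, e)) / 4"
    if "e \<in> {p..q}" for e
    using integral_le_corners[OF assms(1,2) D1c[OF that]] pos
    by (simp add: P_def u_def v_def pos_divide_le_eq mult.commute)
  have Cm: "1 / (u * w) * C e \<le> (f (a, e, p) + f (a, e, q) + f (b, e, p) + f (b, e, q)) / 4"
    if "e \<in> {c..d}" for e
    using integral_le_corners[OF assms(1,3) D2c[OF that]] pos
    by (simp add: C_def u_def w_def pos_divide_le_eq mult.commute)
  have Am: "1 / (v * w) * A e \<le> (f (e, c, p) + f (e, c, q) + f (e, d, p) + f (e, d, q)) / 4"
    if "e \<in> {a..b}" for e
    using integral_le_corners[OF assms(2,3) D3c[OF that]] pos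
    by (simp add: A_def v_def w_def pos_divide_le_eq mult.commute)
  have ends: "a \<in> {a..b}" "b \<in> {a..b}" "c \<in> {c..d}" "d \<in> {c..d}" "p \<in> {p..q}" "q \<in> {p..q}"
    using assms(1-3) by auto
  let ?F = "1 / (u * v) * P p + 1 / (u * v) * P q + 1 / (u * w) * C c + 1 / (u * w) * C d
      + 1 / (v * w) * A a + 1 / (v * w) * A b"
  have "?F \<le> (f (a, c, p) + f (a, d, p) + f (b, c, p) + f (b, d, p)) / 4
      + (f (a, c, q) + f (a, d, q) + f (b, c, q) + f (b, d, q)) / 4
      + (f (a, c, p) + f (a, c, q) + f (b, c, p) + f (b, c, q)) / 4
      + (f (a, d, p) + f (a, d, q) + f (b, d, p) + f (b, d, q)) / 4
      + (f (a, c, p) + f (a, c, q) + f (a, d, p) + f (a, d, q)) / 4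
      + (f (b, c, p) + f (b, c, q) + f (b, d, p) + f (b, d, q)) / 4"
    by (intro add_mono Pm Cm Am ends)
  also have "\<dots> = 6 * ((f (a, c, p) + f (a, d, p) + f (b, c, p) + f (b, d, p)) / 8
        + (f (a, c, q) + f (a, d, q) + f (b, c, q) + f (b, d, q)) / 8)"
    by (simp add: field_simps)
  finally have "1 / 6 * ?F \<le> 1 / 6 * (6 * ((f (a, c, p) + f (a, d, p) + f (b, c, p) + f (b, d, p)) / 8
        + (f (a, c, q) + f (a, d, q) + f (b, c, q) + f (b, d, q)) / 8))"
    by (rule mult_left_mono) simp
  also have "\<dots> = (f (a, c, p) + f (a, d, p) + f (b, c, p) + f (b, d, p)) / 8
        + (f (a, c, q) + f (a, d, q) + f (b, c, q) + f (b, d, q)) / 8"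
    by (simp add: field_simps)
  finally have fourth: "1 / 6 * ?F \<le> (f (a, c, p) + f (a, d, p) + f (b, c, p) + f (b, d, p)) / 8
        + (f (a, c, q) + f (a, d, q) + f (b, c, q) + f (b, d, q)) / 8" .

  have segments: "(\<lambda>x. f (x, ?y, ?z)) integrable_on {a..b}" "(\<lambda>y. f (?x, y, ?z)) integrable_on {c..d}"
    "(\<lambda>z. f (?x, ?y, z)) integrable_on {p..q}"
    using xc yc zc by (simp_all add: integrable_on_cbox_convex flip: box_real(2))
  note faces = D1c[THEN integrable_on_cbox_convex] D2c[THEN integrable_on_cbox_convex]
    D3c[THEN integrable_on_cbox_convex]
  note chain = first second third fourth
  note chain' = chain[unfolded u_def v_def w_def X_def Y_def Z_def P_def C_def A_def I_def]
  show ?thesis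
    unfolding G unfolding D1 D2 D3
    by (intro conjI segments faces ends integrable_on_cbox_convex[OF fc] chain')
qed

end
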